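(* Let $\Gamma\cup\{\varphi\}\subseteq For(\Sigma)$. If $\Gamma\models_{\mathbb{BI}}\varphi$ then $\Gamma\vdash_{\mathbf{RmbC}}\varphi$.
   Context: Let $\Sigma=\{\wedge,\vee,\to,\neg,\circ\}$ ($\neg,\circ$ unary, the others binary) and let $For(\Sigma)$ be the algebra of formulas over $\Sigma$ generated by a denumerable set $\mathcal V$ of propositional variables. $\alpha\leftrightarrow\beta$ abbreviates $(\alpha\to\beta)\wedge(\beta\to\alpha)$. $\mathbf{RmbC}$ is the Hilbert calculus with axiom schemas: (Ax1) $\alpha\to(\beta\to\alpha)$; (Ax2) $(\alpha\to(\beta\to\gamma))\to((\alpha\to\beta)\to(\alpha\to\gamma))$; (Ax3) $\alpha\to(\beta\to(\alpha\wedge\beta))$; (Ax4) $(\alpha\wedge\beta)\to\alpha$; (Ax5) $(\alpha\wedge\beta)\to\beta$; (Ax6) $\alpha\to(\alpha\vee\beta)$; (Ax7) $\beta\to(\alpha\vee\beta)$; (Ax8) $(\alpha\to\gamma)\to((\beta\to\gamma)\to((\alpha\vee\beta)\to\gamma))$; (Ax9) $(\alpha\to\beta)\vee\alpha$; (Ax10) $\alpha\vee\neg\alpha$; (bc1) $\circ\alpha\to(\alpha\to(\neg\alpha\to\beta))$; and rules: (MP) from $\alpha$ and $\alpha\to\beta$ infer $\beta$; $(\mathbf R_\neg)$ from $\alpha\leftrightarrow\beta$ infer $\neg\alpha\leftrightarrow\neg\beta$; $(\mathbf R_\circ)$ from $\alpha\leftrightarrow\beta$ infer $\circ\alpha\leftrightarrow\circ\beta$.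 A formula $\varphi$ is a theorem ($\vdash_{\mathbf{RmbC}}\varphi$) if there is a finite sequence of formulas ending in $\varphi$ each of which is an instance of an axiom schema or follows from earlier formulas of the sequence by a rule. $\Gamma\vdash_{\mathbf{RmbC}}\varphi$ means that either $\vdash_{\mathbf{RmbC}}\varphi$ or there is a finite non-empty $\{\gamma_1,\dots,\gamma_n\}\subseteq\Gamma$ with $\vdash_{\mathbf{RmbC}}(\gamma_1\wedge(\gamma_2\wedge(\cdots\wedge(\gamma_{n-1}\wedge\gamma_n)\cdots)))\to\varphi$. A Boolean algebra with LFI operators (BALFI) is an algebra $\mathcal B=\langle A,\wedge,\vee,\to,\neg,\circ,0,1\rangle$ such that $\langle A,\wedge,\vee,\to,0,1\rangle$ is a Boolean algebra (with $a\to b$ the Boolean implication) and the unary operations $\neg,\circ$ satisfy $a\vee\neg a=1$ and $a\wedge\neg a\wedge\circ a=0$ for all $a\in A$. $\mathbb{BI}$ is the class of BALFIs. A valuation over $\mathcal B$ is a $\Sigma$-homomorphism $v:For(\Sigma)\to\mathcal B$. $\models_{\mathbb{BI}}\varphi$ means $v(\varphi)=1$ for every BALFI $\mathcal B$ and every valuation $v$ over it. $\Gamma\models_{\mathbb{BI}}\varphi$ means that either $\models_{\mathbb{BI}}\varphi$ or there is a finite non-empty $\{\gamma_1,\dots,\gamma_n\}\subseteq\Gamma$ such that $\bigwedge_{i=1}^n v(\gamma_i)\le v(\varphi)$ for every BALFI $\mathcal B$ and every valuation $v$ over it. *)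

theory Defs
  imports Main
begin

section \<open>Formulas\<close>

text \<open>The denumerable set of propositional variables is indexed by the natural numbers.\<close>

datatype fm =
    Var nat
  | Conj fm fm  (infixr "\<^bold>\<and>" 55)
  | Disj fm fm  (infixr "\<^bold>\<or>" 50)
  | Imp fm fm   (infixr "\<^bold>\<rightarrow>" 45)
  | Neg fm      ("\<^bold>\<not> _" [70] 70)
  | Circ fm     ("\<^bold>\<circ> _" [70] 70)

abbreviation Iff :: "fm \<Rightarrow> fm \<Rightarrow> fm"  (infix "\<^bold>\<leftrightarrow>" 40) where
  "\<alpha> \<^bold>\<leftrightarrow> \<beta> \<equiv> (\<alpha> \<^bold>\<rightarrow> \<beta>) \<^bold>\<and> (\<beta> \<^bold>\<rightarrow> \<alpha>)"

text \<open>
  Right-nested iteration of a binary operation over a non-empty list,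
  \<open>f x\<^sub>1 (f x\<^sub>2 (\<dots> (f x\<^sub>n\<^sub>-\<^sub>1 x\<^sub>n)))\<close>; the value on the empty list is
  unspecified and never used.
\<close>

fun iter_right :: "('a \<Rightarrow> 'a \<Rightarrow> 'a) \<Rightarrow> 'a list \<Rightarrow> 'a" where
  "iter_right f [x] = x"
| "iter_right f (x # y # zs) = f x (iter_right f (y # zs))"

section \<open>The Hilbert calculus RmbC\<close>

inductive axiom :: "fm \<Rightarrow> bool" where
  Ax1: "axiom (\<alpha> \<^bold>\<rightarrow> (\<beta> \<^bold>\<rightarrow> \<alpha>))"
| Ax2: "axiom ((\<alpha> \<^bold>\<rightarrow> (\<beta> \<^bold>\<rightarrow> \<gamma>)) \<^bold>\<rightarrow> ((\<alpha> \<^bold>\<rightarrow> \<beta>) \<^bold>\<rightarrow> (\<alpha> \<^bold>\<rightarrow> \<gamma>)))"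
| Ax3: "axiom (\<alpha> \<^bold>\<rightarrow> (\<beta> \<^bold>\<rightarrow> (\<alpha> \<^bold>\<and> \<beta>)))"
| Ax4: "axiom ((\<alpha> \<^bold>\<and> \<beta>) \<^bold>\<rightarrow> \<alpha>)"
| Ax5: "axiom ((\<alpha> \<^bold>\<and> \<beta>) \<^bold>\<rightarrow> \<beta>)"
| Ax6: "axiom (\<alpha> \<^bold>\<rightarrow> (\<alpha> \<^bold>\<or> \<beta>))"
| Ax7: "axiom (\<beta> \<^bold>\<rightarrow> (\<alpha> \<^bold>\<or> \<beta>))"
| Ax8: "axiom ((\<alpha> \<^bold>\<rightarrow> \<gamma>) \<^bold>\<rightarrow> ((\<beta> \<^bold>\<rightarrow> \<gamma>) \<^bold>\<rightarrow> ((\<alpha> \<^bold>\<or> \<beta>) \<^bold>\<rightarrow> \<gamma>)))"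
| Ax9: "axiom ((\<alpha> \<^bold>\<rightarrow> \<beta>) \<^bold>\<or> \<alpha>)"
| Ax10: "axiom (\<alpha> \<^bold>\<or> (\<^bold>\<not> \<alpha>))"
| bc1: "axiom ((\<^bold>\<circ> \<alpha>) \<^bold>\<rightarrow> (\<alpha> \<^bold>\<rightarrow> ((\<^bold>\<not> \<alpha>) \<^bold>\<rightarrow> \<beta>)))"

text \<open>\<open>inferred S \<phi>\<close>: the formula \<open>\<phi>\<close> is the conclusion of a rule with premises in \<open>S\<close>.\<close>

inductive inferred :: "fm set \<Rightarrow> fm \<Rightarrow> bool" for S where
  MP: "\<alpha> \<in> S \<Longrightarrow> (\<alpha> \<^bold>\<rightarrow> \<beta>) \<in> S \<Longrightarrow> inferred S \<beta>"
| R_neg: "(\<alpha> \<^bold>\<leftrightarrow> \<beta>) \<in> S \<Longrightarrow> inferred S ((\<^bold>\<not> \<alpha>) \<^bold>\<leftrightarrow> (\<^bold>\<not> \<beta>))"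
| R_circ: "(\<alpha> \<^bold>\<leftrightarrow> \<beta>) \<in> S \<Longrightarrow> inferred S ((\<^bold>\<circ> \<alpha>) \<^bold>\<leftrightarrow> (\<^bold>\<circ> \<beta>))"

definition derivation :: "fm list \<Rightarrow> bool" where
  "derivation s \<longleftrightarrow> (\<forall>i < length s. axiom (s ! i) \<or> inferred (set (take i s)) (s ! i))"

definition RmbC_theorem :: "fm \<Rightarrow> bool"  ("\<turnstile>\<^sub>R\<^sub>m\<^sub>b\<^sub>C _" [40] 40) where
  "\<turnstile>\<^sub>R\<^sub>m\<^sub>b\<^sub>C \<phi> \<longleftrightarrow> (\<exists>s. s \<noteq> [] \<and> derivation s \<and> last s = \<phi>)"

definition RmbC_consequence :: "fm set \<Rightarrow> fm \<Rightarrow> bool"  (infix "\<turnstile>\<^sub>R\<^sub>m\<^sub>b\<^sub>C" 40) where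
  "\<Gamma> \<turnstile>\<^sub>R\<^sub>m\<^sub>b\<^sub>C \<phi> \<longleftrightarrow>
     (\<turnstile>\<^sub>R\<^sub>m\<^sub>b\<^sub>C \<phi>) \<or>
     (\<exists>\<gamma>s. \<gamma>s \<noteq> [] \<and> set \<gamma>s \<subseteq> \<Gamma> \<and> (\<turnstile>\<^sub>R\<^sub>m\<^sub>b\<^sub>C (iter_right Conj \<gamma>s \<^bold>\<rightarrow> \<phi>)))"

section \<open>Boolean algebras with LFI operators\<close>

record 'a lfi_algebra =
  carrier :: "'a set"
  meet :: "'a \<Rightarrow> 'a \<Rightarrow> 'a"
  join :: "'a \<Rightarrow> 'a \<Rightarrow> 'a"
  imp :: "'a \<Rightarrow> 'a \<Rightarrow> 'a"
  neg :: "'a \<Rightarrow> 'a"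
  circ :: "'a \<Rightarrow> 'a"
  zero :: 'a
  one :: 'a

text \<open>
  Library Boolean algebras live on a whole type; here the carrier has to range over
  subsets of a type, so the axioms of \<^locale>\<open>abstract_boolean_algebra\<close> are
  relativised to it. The Boolean complement of \<open>a\<close> is \<open>a \<rightarrow> 0\<close> and \<open>a \<rightarrow> b\<close> is
  the join of that complement with \<open>b\<close>. One-element algebras are not excluded.
\<close>

locale boolean_reduct =
  fixes B :: "'a lfi_algebra"
  assumes meet_closed: "a \<in> carrier B \<Longrightarrow> b \<in> carrier B \<Longrightarrow> meet B a b \<in> carrier B"
    and join_closed: "a \<in> carrier B \<Longrightarrow> b \<in> carrier B \<Longrightarrow> join B a b \<in> carrier B"
    and imp_closed: "a \<in> carrier B \<Longrightarrow> b \<in> carrier B \<Longrightarrow> imp B a b \<in> carrier B"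
    and zero_closed: "zero B \<in> carrier B"
    and one_closed: "one B \<in> carrier B"
    and meet_assoc: "a \<in> carrier B \<Longrightarrow> b \<in> carrier B \<Longrightarrow> c \<in> carrier B \<Longrightarrow>
      meet B (meet B a b) c = meet B a (meet B b c)"
    and meet_commute: "a \<in> carrier B \<Longrightarrow> b \<in> carrier B \<Longrightarrow> meet B a b = meet B b a"
    and join_assoc: "a \<in> carrier B \<Longrightarrow> b \<in> carrier B \<Longrightarrow> c \<in> carrier B \<Longrightarrow>
      join B (join B a b) c = join B a (join B b c)"
    and join_commute: "a \<in> carrier B \<Longrightarrow> b \<in> carrier B \<Longrightarrow> join B a b = join B b a"
    and meet_join_distrib: "a \<in> carrier B \<Longrightarrow> b \<in> carrier B \<Longrightarrow> c \<in> carrier B \<Longrightarrow>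
      meet B a (join B b c) = join B (meet B a b) (meet B a c)"
    and join_meet_distrib: "a \<in> carrier B \<Longrightarrow> b \<in> carrier B \<Longrightarrow> c \<in> carrier B \<Longrightarrow>
      join B a (meet B b c) = meet B (join B a b) (join B a c)"
    and meet_one: "a \<in> carrier B \<Longrightarrow> meet B a (one B) = a"
    and join_zero: "a \<in> carrier B \<Longrightarrow> join B a (zero B) = a"
    and meet_compl: "a \<in> carrier B \<Longrightarrow> meet B a (imp B a (zero B)) = zero B"
    and join_compl: "a \<in> carrier B \<Longrightarrow> join B a (imp B a (zero B)) = one B"
    and imp_eq: "a \<in> carrier B \<Longrightarrow> b \<in> carrier B \<Longrightarrow>
      imp B a b = join B (imp B a (zero B)) b"

lemma boolean_reduct_UNIV_iff:
  assumes "carrier B = UNIV"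
  shows "boolean_reduct B \<longleftrightarrow>
    abstract_boolean_algebra (meet B) (join B) (\<lambda>a. imp B a (zero B)) (zero B) (one B) \<and>
    (\<forall>a b. imp B a b = join B (imp B a (zero B)) b)"
  unfolding boolean_reduct_def abstract_boolean_algebra_def abel_semigroup_def
    abel_semigroup_axioms_def semigroup_def abstract_boolean_algebra_axioms_def
  using assms by auto

locale balfi = boolean_reduct +
  assumes neg_closed: "a \<in> carrier B \<Longrightarrow> neg B a \<in> carrier B"
    and circ_closed: "a \<in> carrier B \<Longrightarrow> circ B a \<in> carrier B"
    and join_neg: "a \<in> carrier B \<Longrightarrow> join B a (neg B a) = one B"
    and meet_neg_circ: "a \<in> carrier B \<Longrightarrow> meet B (meet B a (neg B a)) (circ B a) = zero B"

definition le :: "'a lfi_algebra \<Rightarrow> 'a \<Rightarrow> 'a \<Rightarrow> bool" where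
  "le B a b \<longleftrightarrow> meet B a b = a"

definition valuation :: "'a lfi_algebra \<Rightarrow> (fm \<Rightarrow> 'a) \<Rightarrow> bool" where
  "valuation B v \<longleftrightarrow>
     (\<forall>\<alpha>. v \<alpha> \<in> carrier B) \<and>
     (\<forall>\<alpha> \<beta>. v (\<alpha> \<^bold>\<and> \<beta>) = meet B (v \<alpha>) (v \<beta>)) \<and>
     (\<forall>\<alpha> \<beta>. v (\<alpha> \<^bold>\<or> \<beta>) = join B (v \<alpha>) (v \<beta>)) \<and>
     (\<forall>\<alpha> \<beta>. v (\<alpha> \<^bold>\<rightarrow> \<beta>) = imp B (v \<alpha>) (v \<beta>)) \<and>
     (\<forall>\<alpha>. v (\<^bold>\<not> \<alpha>) = neg B (v \<alpha>)) \<and>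
     (\<forall>\<alpha>. v (\<^bold>\<circ> \<alpha>) = circ B (v \<alpha>))"

text \<open>
  HOL cannot quantify over types inside a formula, so the class of all BALFIs is
  represented by the BALFIs whose carrier is an arbitrary subset of a universe type
  \<open>'a\<close>, passed as \<^term>\<open>TYPE('a)\<close>. For infinite \<open>'a\<close> this comprises, up to isomorphism,
  all finite and all countable BALFIs, and all BALFIs of cardinality at most that
  of \<open>'a\<close>. Validity in all BALFIs implies validity over each universe, so a
  completeness theorem for every infinite universe covers the class of all BALFIs.
\<close>

definition BI_valid :: "'a itself \<Rightarrow> fm \<Rightarrow> bool" where
  "BI_valid (_ :: 'a itself) \<phi> \<longleftrightarrow>
     (\<forall>(B :: 'a lfi_algebra) v. balfi B \<longrightarrow> valuation B v \<longrightarrow> v \<phi> = one B)"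

definition BI_consequence :: "'a itself \<Rightarrow> fm set \<Rightarrow> fm \<Rightarrow> bool" where
  "BI_consequence (U :: 'a itself) \<Gamma> \<phi> \<longleftrightarrow>
     BI_valid U \<phi> \<or>
     (\<exists>\<gamma>s. \<gamma>s \<noteq> [] \<and> set \<gamma>s \<subseteq> \<Gamma> \<and>
        (\<forall>(B :: 'a lfi_algebra) v. balfi B \<longrightarrow> valuation B v \<longrightarrow>
           le B (iter_right (meet B) (map v \<gamma>s)) (v \<phi>)))"

end

theory Submission
  imports Defs "HOL-Library.Countable"
begin

text \<open>
  The Lindenbaum-Tarski algebra of RmbC, formulas modulo provable equivalence, is a BALFI:
  \<open>R_neg\<close> and \<open>R_circ\<close> make \<open>\<not>\<close> and \<open>\<circ>\<close> well defined on classes, Ax10 and bc1 give the BALFI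
  identities. The class map is a valuation sending exactly the theorems to \<open>1\<close>. As
  there are only countably many formulas, the algebra can be copied into any infinite universe.
\<close>

section \<open>Provable implication\<close>

lemma derivation_append:
  assumes "derivation s" and "derivation t"
  shows "derivation (s @ t)"
  unfolding derivation_def
proof (intro allI impI)
  fix i assume i: "i < length (s @ t)"
  \<comment> \<open>A formula of \<open>t\<close> keeps its earlier formulas in \<open>s @ t\<close>
    and gains all of \<open>s\<close>; rule application is monotone in the set of available
    premises.\<close>
  have mono: "inferred S \<beta> \<Longrightarrow> S \<subseteq> T \<Longrightarrow> inferred T \<beta>" for S T \<beta>
    by (auto elim!: inferred.cases intro: inferred.intros)
  show "axiom ((s @ t) ! i) \<or> inferred (set (take i (s @ t))) ((s @ t) ! i)"
  proof (cases "i < length s")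
    case True
    then show ?thesis using assms(1) by (auto simp: derivation_def nth_append)
  next
    case False
    then have "axiom (t ! (i - length s)) \<or>
        inferred (set (take (i - length s) t)) (t ! (i - length s))"
      using assms(2) i by (auto simp: derivation_def)
    then show ?thesis using False mono by (auto simp: nth_append)
  qed
qed

lemma derivation_snoc:
  assumes "derivation s" and "axiom \<phi> \<or> inferred (set s) \<phi>"
  shows "derivation (s @ [\<phi>])"
  unfolding derivation_def
proof (intro allI impI)
  fix i assume "i < length (s @ [\<phi>])"
  then consider "i < length s" | "i = length s" by fastforce
  then show "axiom ((s @ [\<phi>]) ! i) \<or> inferred (set (take i (s @ [\<phi>]))) ((s @ [\<phi>]) ! i)"
    using assms by cases (simp_all add: derivation_def nth_append)
qed

lemma thm_axiom:
  assumes "axiom \<phi>"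
  shows "\<turnstile>\<^sub>R\<^sub>m\<^sub>b\<^sub>C \<phi>"
proof -
  have "derivation ([] @ [\<phi>])"
    using assms by (intro derivation_snoc) (auto simp: derivation_def)
  then show ?thesis unfolding RmbC_theorem_def by (intro exI[of _ "[\<phi>]"]) simp
qed

text \<open>Concatenating the two derivations makes both premises available to one final step.
  \<open>step\<close> ranges over all \<open>S\<close> because the set of formulas in the
  concatenation is arbitrary; the one-premise rules use their premise for both \<alpha> and
  \<beta>.\<close>

lemma thm_inferred2:
  assumes "\<turnstile>\<^sub>R\<^sub>m\<^sub>b\<^sub>C \<alpha>" and "\<turnstile>\<^sub>R\<^sub>m\<^sub>b\<^sub>C \<beta>" and step: "\<And>S. \<alpha> \<in> S \<Longrightarrow> \<beta> \<in> S \<Longrightarrow> inferred S \<gamma>"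
  shows "\<turnstile>\<^sub>R\<^sub>m\<^sub>b\<^sub>C \<gamma>"
proof -
  obtain s t where "s \<noteq> []" "derivation s" "last s = \<alpha>" "t \<noteq> []" "derivation t" "last t = \<beta>"
    using assms(1,2) by (auto simp: RmbC_theorem_def)
  then have "derivation ((s @ t) @ [\<gamma>])"
    by (intro derivation_snoc derivation_append disjI2 step) auto
  then show ?thesis unfolding RmbC_theorem_def by (intro exI[of _ "(s @ t) @ [\<gamma>]"]) simp
qed

lemma thm_MP: "\<turnstile>\<^sub>R\<^sub>m\<^sub>b\<^sub>C \<alpha> \<Longrightarrow> \<turnstile>\<^sub>R\<^sub>m\<^sub>b\<^sub>C (\<alpha> \<^bold>\<rightarrow> \<beta>) \<Longrightarrow> \<turnstile>\<^sub>R\<^sub>m\<^sub>b\<^sub>C \<beta>"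
  by (rule thm_inferred2[OF _ _ inferred.MP])

lemma thm_R_neg: "\<turnstile>\<^sub>R\<^sub>m\<^sub>b\<^sub>C (\<alpha> \<^bold>\<leftrightarrow> \<beta>) \<Longrightarrow> \<turnstile>\<^sub>R\<^sub>m\<^sub>b\<^sub>C ((\<^bold>\<not> \<alpha>) \<^bold>\<leftrightarrow> (\<^bold>\<not> \<beta>))"
  by (rule thm_inferred2, assumption, assumption) (rule inferred.R_neg)

lemma thm_R_circ: "\<turnstile>\<^sub>R\<^sub>m\<^sub>b\<^sub>C (\<alpha> \<^bold>\<leftrightarrow> \<beta>) \<Longrightarrow> \<turnstile>\<^sub>R\<^sub>m\<^sub>b\<^sub>C ((\<^bold>\<circ> \<alpha>) \<^bold>\<leftrightarrow> (\<^bold>\<circ> \<beta>))"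
  by (rule thm_inferred2, assumption, assumption) (rule inferred.R_circ)

section \<open>The preorder of provable implication and its lattice laws\<close>

definition ent :: "fm \<Rightarrow> fm \<Rightarrow> bool"  (infix "\<preceq>" 40) where
  "\<alpha> \<preceq> \<beta> \<longleftrightarrow> (\<turnstile>\<^sub>R\<^sub>m\<^sub>b\<^sub>C (\<alpha> \<^bold>\<rightarrow> \<beta>))"

text \<open>The signature has no constants, so top and bottom are concrete formulas: an instance of
  Ax1, and the jointly explosive premises of bc1 for \<open>Var 0\<close>.\<close>

definition verum :: fm where
  "verum = (Var 0 \<^bold>\<rightarrow> (Var 0 \<^bold>\<rightarrow> Var 0))"

definition falsum :: fm where
  "falsum = (Var 0 \<^bold>\<and> \<^bold>\<not> Var 0) \<^bold>\<and> \<^bold>\<circ> Var 0"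

lemma thm_imp_weaken: "\<turnstile>\<^sub>R\<^sub>m\<^sub>b\<^sub>C \<beta> \<Longrightarrow> \<alpha> \<preceq> \<beta>"
  unfolding ent_def by (erule thm_MP) (rule thm_axiom[OF Ax1])

text \<open>Ax2 allows modus ponens under a common antecedent \<gamma>, which thus serves as a
  context in the arguments below.\<close>

lemma ent_MP: "\<gamma> \<preceq> \<alpha> \<Longrightarrow> \<gamma> \<preceq> \<alpha> \<^bold>\<rightarrow> \<beta> \<Longrightarrow> \<gamma> \<preceq> \<beta>"
  unfolding ent_def by (erule thm_MP, erule thm_MP) (rule thm_axiom[OF Ax2])

lemma ent_trans: "\<alpha> \<preceq> \<beta> \<Longrightarrow> \<beta> \<preceq> \<gamma> \<Longrightarrow> \<alpha> \<preceq> \<gamma>"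
  by (rule ent_MP[of _ \<beta>]) (simp_all add: ent_def[of \<beta>] thm_imp_weaken)

lemma ent_axiom: "axiom (\<alpha> \<^bold>\<rightarrow> \<beta>) \<Longrightarrow> \<alpha> \<preceq> \<beta>"
  unfolding ent_def by (rule thm_axiom)

lemma ent_refl: "\<alpha> \<preceq> \<alpha>"
  \<comment> \<open>The combinator identity I = SKK: both premises are instances of Ax1.\<close>
  by (rule ent_MP[OF ent_axiom[OF Ax1] ent_axiom[OF Ax1]])

text \<open>Ax1 gives one direction, detaching the theorem \<open>verum\<close> the other. Claims
  about theorems thereby become claims about the order.\<close>

lemma thm_iff_ent_verum: "(\<turnstile>\<^sub>R\<^sub>m\<^sub>b\<^sub>C \<alpha>) \<longleftrightarrow> verum \<preceq> \<alpha>"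
proof -
  have "\<turnstile>\<^sub>R\<^sub>m\<^sub>b\<^sub>C verum" unfolding verum_def by (intro thm_axiom axiom.intros)
  then show ?thesis using thm_MP thm_imp_weaken unfolding ent_def by blast
qed

lemma ent_verum: "\<alpha> \<preceq> verum"
  by (rule thm_imp_weaken) (simp add: thm_iff_ent_verum ent_refl)

lemma ent_conjI: "\<gamma> \<preceq> \<alpha> \<Longrightarrow> \<gamma> \<preceq> \<beta> \<Longrightarrow> \<gamma> \<preceq> \<alpha> \<^bold>\<and> \<beta>"
  by (rule ent_MP[OF _ ent_trans[OF _ ent_axiom[OF Ax3]]])

lemma ent_conj1: "\<alpha> \<preceq> \<gamma> \<Longrightarrow> \<alpha> \<^bold>\<and> \<beta> \<preceq> \<gamma>"
  by (rule ent_trans[OF ent_axiom[OF Ax4]])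

lemma ent_conj2: "\<beta> \<preceq> \<gamma> \<Longrightarrow> \<alpha> \<^bold>\<and> \<beta> \<preceq> \<gamma>"
  by (rule ent_trans[OF ent_axiom[OF Ax5]])

lemma ent_disj1: "\<gamma> \<preceq> \<alpha> \<Longrightarrow> \<gamma> \<preceq> \<alpha> \<^bold>\<or> \<beta>"
  by (rule ent_trans[OF _ ent_axiom[OF Ax6]])

lemma ent_disj2: "\<gamma> \<preceq> \<beta> \<Longrightarrow> \<gamma> \<preceq> \<alpha> \<^bold>\<or> \<beta>"
  by (rule ent_trans[OF _ ent_axiom[OF Ax7]])

lemma ent_disjE: "\<alpha> \<preceq> \<gamma> \<Longrightarrow> \<beta> \<preceq> \<gamma> \<Longrightarrow> \<alpha> \<^bold>\<or> \<beta> \<preceq> \<gamma>"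
  unfolding ent_def by (erule thm_MP, erule thm_MP) (rule thm_axiom[OF Ax8])

lemma ent_conj_swap: "\<alpha> \<^bold>\<and> \<beta> \<preceq> \<gamma> \<Longrightarrow> \<beta> \<^bold>\<and> \<alpha> \<preceq> \<gamma>"
  by (rule ent_trans[of _ "\<alpha> \<^bold>\<and> \<beta>"]) (intro ent_conjI ent_conj1[OF ent_refl] ent_conj2[OF ent_refl])

text \<open>Ax3 pairs \<gamma> with \<alpha>, and Ax2 composes the result with the hypothesis under
  \<alpha>. Together with \<open>ent_impE\<close> this is residuation, which does the work of a
  deduction theorem.\<close>

lemma ent_impI:
  assumes "\<gamma> \<^bold>\<and> \<alpha> \<preceq> \<beta>"
  shows "\<gamma> \<preceq> \<alpha> \<^bold>\<rightarrow> \<beta>"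
proof -
  have "\<gamma> \<preceq> \<alpha> \<^bold>\<rightarrow> (\<gamma> \<^bold>\<and> \<alpha>)" by (intro ent_axiom axiom.intros)
  moreover have "\<gamma> \<preceq> \<alpha> \<^bold>\<rightarrow> ((\<gamma> \<^bold>\<and> \<alpha>) \<^bold>\<rightarrow> \<beta>)"
    using assms by (intro thm_imp_weaken) (metis ent_def thm_imp_weaken)
  ultimately show ?thesis using ent_MP ent_trans[OF _ ent_axiom[OF Ax2]] by blast
qed

lemma ent_impE: "\<gamma> \<preceq> \<alpha> \<^bold>\<rightarrow> \<beta> \<Longrightarrow> \<gamma> \<^bold>\<and> \<alpha> \<preceq> \<beta>"
  by (rule ent_MP[OF ent_conj2[OF ent_refl] ent_conj1])

lemma ent_conj_iff: "\<gamma> \<preceq> \<alpha> \<^bold>\<and> \<beta> \<longleftrightarrow> \<gamma> \<preceq> \<alpha> \<and> \<gamma> \<preceq> \<beta>"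
  using ent_trans[OF _ ent_conj1[OF ent_refl]] ent_trans[OF _ ent_conj2[OF ent_refl]] ent_conjI
  by blast

lemma ent_disj_iff: "\<alpha> \<^bold>\<or> \<beta> \<preceq> \<gamma> \<longleftrightarrow> \<alpha> \<preceq> \<gamma> \<and> \<beta> \<preceq> \<gamma>"
  using ent_trans[OF ent_disj1[OF ent_refl]] ent_trans[OF ent_disj2[OF ent_refl]] ent_disjE
  by blast

text \<open>Residuation moves \<gamma> to the right of the order, where Ax8 splits the disjunction;
  this is the source of distributivity.\<close>

lemma ent_conj_disjE:
  assumes "\<gamma> \<^bold>\<and> \<alpha> \<preceq> \<delta>" and "\<gamma> \<^bold>\<and> \<beta> \<preceq> \<delta>"
  shows "\<gamma> \<^bold>\<and> (\<alpha> \<^bold>\<or> \<beta>) \<preceq> \<delta>"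
proof -
  have "\<alpha> \<^bold>\<and> \<gamma> \<preceq> \<delta>" "\<beta> \<^bold>\<and> \<gamma> \<preceq> \<delta>"
    using assms by (auto intro: ent_conj_swap)
  then have "\<alpha> \<^bold>\<or> \<beta> \<preceq> \<gamma> \<^bold>\<rightarrow> \<delta>" by (intro ent_disjE ent_impI)
  then have "(\<alpha> \<^bold>\<or> \<beta>) \<^bold>\<and> \<gamma> \<preceq> \<delta>" by (rule ent_impE)
  then show ?thesis by (rule ent_conj_swap)
qed

text \<open>A provable disjunction can be conjoined to any antecedent and then distributed. With Ax9
  this yields classical case analysis.\<close>

lemma ent_cases:
  assumes "\<turnstile>\<^sub>R\<^sub>m\<^sub>b\<^sub>C (\<alpha> \<^bold>\<or> \<beta>)" and "\<gamma> \<^bold>\<and> \<alpha> \<preceq> \<delta>" and "\<gamma> \<^bold>\<and> \<beta> \<preceq> \<delta>"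
  shows "\<gamma> \<preceq> \<delta>"
  by (rule ent_trans[OF ent_conjI[OF ent_refl thm_imp_weaken[OF assms(1)]]
        ent_conj_disjE[OF assms(2,3)]])

lemma ent_inconsistent: "(\<alpha> \<^bold>\<and> \<^bold>\<not> \<alpha>) \<^bold>\<and> \<^bold>\<circ> \<alpha> \<preceq> \<beta>"
proof -
  let ?\<gamma> = "(\<alpha> \<^bold>\<and> \<^bold>\<not> \<alpha>) \<^bold>\<and> \<^bold>\<circ> \<alpha>"
  have "?\<gamma> \<preceq> \<alpha> \<^bold>\<rightarrow> (\<^bold>\<not> \<alpha> \<^bold>\<rightarrow> \<beta>)"
    by (intro ent_conj2 ent_axiom axiom.intros)
  moreover have "?\<gamma> \<preceq> \<alpha>" "?\<gamma> \<preceq> \<^bold>\<not> \<alpha>"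
    by (auto intro: ent_conj1 ent_conj2 ent_refl)
  ultimately show ?thesis using ent_MP by blast
qed

lemma ent_falsum: "falsum \<preceq> \<alpha>"
  unfolding falsum_def by (rule ent_inconsistent)

section \<open>Provable equivalence\<close>

definition equi :: "fm \<Rightarrow> fm \<Rightarrow> bool"  (infix "\<approx>" 40) where
  "\<alpha> \<approx> \<beta> \<longleftrightarrow> \<alpha> \<preceq> \<beta> \<and> \<beta> \<preceq> \<alpha>"

lemma thm_Iff: "(\<turnstile>\<^sub>R\<^sub>m\<^sub>b\<^sub>C (\<alpha> \<^bold>\<leftrightarrow> \<beta>)) \<longleftrightarrow> \<alpha> \<approx> \<beta>"
  \<comment> \<open>The instances of \<open>ent_def\<close> leave \<open>verum \<preceq> _\<close>
    folded, so both sides become order statements about \<open>verum\<close>.\<close>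
  unfolding equi_def ent_def[of \<alpha>] ent_def[of \<beta>] thm_iff_ent_verum by (rule ent_conj_iff)

lemma equivp_equi: "equivp (\<approx>)"
  by (rule equivpI) (auto simp: reflp_def symp_def transp_def equi_def intro: ent_refl ent_trans)

section \<open>Compatibility of the connectives with provable equivalence\<close>

lemma equi_conj: "\<alpha> \<approx> \<alpha>' \<Longrightarrow> \<beta> \<approx> \<beta>' \<Longrightarrow> \<alpha> \<^bold>\<and> \<beta> \<approx> \<alpha>' \<^bold>\<and> \<beta>'"
  unfolding equi_def by (auto intro: ent_conjI ent_conj1 ent_conj2)

lemma equi_disj: "\<alpha> \<approx> \<alpha>' \<Longrightarrow> \<beta> \<approx> \<beta>' \<Longrightarrow> \<alpha> \<^bold>\<or> \<beta> \<approx> \<alpha>' \<^bold>\<or> \<beta>'"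
  unfolding equi_def by (auto intro: ent_disjE ent_disj1 ent_disj2)

lemma ent_imp_mono: "\<alpha>' \<preceq> \<alpha> \<Longrightarrow> \<beta> \<preceq> \<beta>' \<Longrightarrow> \<alpha> \<^bold>\<rightarrow> \<beta> \<preceq> \<alpha>' \<^bold>\<rightarrow> \<beta>'"
  by (rule ent_impI) (rule ent_trans[OF ent_MP[OF ent_conj2 ent_conj1[OF ent_refl]]])

lemma equi_imp: "\<alpha> \<approx> \<alpha>' \<Longrightarrow> \<beta> \<approx> \<beta>' \<Longrightarrow> \<alpha> \<^bold>\<rightarrow> \<beta> \<approx> \<alpha>' \<^bold>\<rightarrow> \<beta>'"
  unfolding equi_def by (simp add: ent_imp_mono)

lemma equi_neg: "\<alpha> \<approx> \<beta> \<Longrightarrow> \<^bold>\<not> \<alpha> \<approx> \<^bold>\<not> \<beta>"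
  using thm_R_neg by (simp add: thm_Iff)

lemma equi_circ: "\<alpha> \<approx> \<beta> \<Longrightarrow> \<^bold>\<circ> \<alpha> \<approx> \<^bold>\<circ> \<beta>"
  using thm_R_circ by (simp add: thm_Iff)

lemma equi_verum_iff: "\<alpha> \<approx> verum \<longleftrightarrow> (\<turnstile>\<^sub>R\<^sub>m\<^sub>b\<^sub>C \<alpha>)"
  by (simp add: equi_def ent_verum thm_iff_ent_verum)

text \<open>The left side is the shape of \<open>le\<close> on classes, so the algebraic order of
  the quotient is provable implication.\<close>

lemma equi_conj_absorb_iff: "\<alpha> \<^bold>\<and> \<beta> \<approx> \<alpha> \<longleftrightarrow> \<alpha> \<preceq> \<beta>"
  by (auto simp: equi_def ent_conj_iff intro: ent_conj1 ent_refl)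

section \<open>Boolean and BALFI laws modulo provable equivalence\<close>

lemma equi_conj_assoc: "(\<alpha> \<^bold>\<and> \<beta>) \<^bold>\<and> \<gamma> \<approx> \<alpha> \<^bold>\<and> (\<beta> \<^bold>\<and> \<gamma>)"
  unfolding equi_def ent_conj_iff by (blast intro: ent_conj1 ent_conj2 ent_refl)

lemma equi_conj_commute: "\<alpha> \<^bold>\<and> \<beta> \<approx> \<beta> \<^bold>\<and> \<alpha>"
  by (simp add: equi_def ent_conj_swap ent_refl)

lemma equi_disj_assoc: "(\<alpha> \<^bold>\<or> \<beta>) \<^bold>\<or> \<gamma> \<approx> \<alpha> \<^bold>\<or> (\<beta> \<^bold>\<or> \<gamma>)"
  unfolding equi_def ent_disj_iff by (blast intro: ent_disj1 ent_disj2 ent_refl)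

lemma equi_disj_commute: "\<alpha> \<^bold>\<or> \<beta> \<approx> \<beta> \<^bold>\<or> \<alpha>"
  unfolding equi_def ent_disj_iff by (blast intro: ent_disj1 ent_disj2 ent_refl)

lemma equi_conj_verum: "\<alpha> \<^bold>\<and> verum \<approx> \<alpha>"
  by (simp add: equi_conj_absorb_iff ent_verum)

lemma equi_disj_falsum: "\<alpha> \<^bold>\<or> falsum \<approx> \<alpha>"
  by (simp add: equi_def ent_disj_iff ent_refl ent_falsum ent_disj1)

lemma equi_disj_neg: "\<alpha> \<^bold>\<or> \<^bold>\<not> \<alpha> \<approx> verum"
  by (simp add: equi_verum_iff thm_axiom Ax10)

lemma equi_conj_neg_circ: "(\<alpha> \<^bold>\<and> \<^bold>\<not> \<alpha>) \<^bold>\<and> \<^bold>\<circ> \<alpha> \<approx> falsum"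
  by (simp add: equi_def ent_inconsistent ent_falsum)

lemma equi_conj_disj_distrib: "\<alpha> \<^bold>\<and> (\<beta> \<^bold>\<or> \<gamma>) \<approx> (\<alpha> \<^bold>\<and> \<beta>) \<^bold>\<or> (\<alpha> \<^bold>\<and> \<gamma>)"
  unfolding equi_def
  by (auto simp: ent_conj_iff ent_disj_iff
      intro: ent_conj_disjE ent_disj1 ent_disj2 ent_conj1 ent_conj2 ent_refl)

lemma equi_disj_conj_distrib: "\<alpha> \<^bold>\<or> (\<beta> \<^bold>\<and> \<gamma>) \<approx> (\<alpha> \<^bold>\<or> \<beta>) \<^bold>\<and> (\<alpha> \<^bold>\<or> \<gamma>)"
proof -
  let ?\<delta> = "\<alpha> \<^bold>\<or> (\<beta> \<^bold>\<and> \<gamma>)"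
  \<comment> \<open>For the harder direction the two disjunctions are split one at a time: first
    \<alpha> \<or> \<beta> in the context \<gamma>, then \<alpha> \<or> \<gamma> in the context
    \<alpha> \<or> \<beta>.\<close>
  have "\<gamma> \<^bold>\<and> \<beta> \<preceq> ?\<delta>"
    by (rule ent_conj_swap) (rule ent_disj2[OF ent_refl])
  then have "\<gamma> \<^bold>\<and> (\<alpha> \<^bold>\<or> \<beta>) \<preceq> ?\<delta>"
    by (intro ent_conj_disjE) (auto intro: ent_disj1 ent_conj2 ent_refl)
  then have "(\<alpha> \<^bold>\<or> \<beta>) \<^bold>\<and> \<gamma> \<preceq> ?\<delta>"
    by (rule ent_conj_swap)
  then have "(\<alpha> \<^bold>\<or> \<beta>) \<^bold>\<and> (\<alpha> \<^bold>\<or> \<gamma>) \<preceq> ?\<delta>"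
    by (intro ent_conj_disjE) (auto intro: ent_disj1 ent_conj2 ent_refl)
  then show ?thesis unfolding equi_def
    by (auto simp: ent_conj_iff ent_disj_iff
        intro: ent_disj1 ent_disj2 ent_conj1 ent_conj2 ent_refl)
qed

lemma equi_imp_disj: "\<alpha> \<^bold>\<rightarrow> \<beta> \<approx> (\<alpha> \<^bold>\<rightarrow> falsum) \<^bold>\<or> \<beta>"
proof -
  \<comment> \<open>This instance of Ax9 is the classical case split: the first case is already a
    disjunct of the goal, and in the second \<beta> follows from the implication.\<close>
  have "\<turnstile>\<^sub>R\<^sub>m\<^sub>b\<^sub>C ((\<alpha> \<^bold>\<rightarrow> falsum) \<^bold>\<or> \<alpha>)"
    by (intro thm_axiom axiom.intros)
  then have "\<alpha> \<^bold>\<rightarrow> \<beta> \<preceq> (\<alpha> \<^bold>\<rightarrow> falsum) \<^bold>\<or> \<beta>"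
    by (rule ent_cases) (auto intro: ent_disj1 ent_disj2 ent_conj2 ent_impE ent_refl)
  then show ?thesis unfolding equi_def ent_disj_iff
    by (auto intro: ent_imp_mono ent_falsum ent_refl ent_impI ent_conj1)
qed

lemma equi_disj_compl: "\<alpha> \<^bold>\<or> (\<alpha> \<^bold>\<rightarrow> falsum) \<approx> verum"
proof -
  have "verum \<preceq> (\<alpha> \<^bold>\<rightarrow> falsum) \<^bold>\<or> \<alpha>"
    by (intro thm_imp_weaken thm_axiom axiom.intros)
  then have "verum \<preceq> \<alpha> \<^bold>\<or> (\<alpha> \<^bold>\<rightarrow> falsum)"
    by (rule ent_trans) (intro ent_disjE ent_disj1[OF ent_refl] ent_disj2[OF ent_refl])
  then show ?thesis by (simp add: equi_def ent_verum)
qed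

lemma equi_conj_compl: "\<alpha> \<^bold>\<and> (\<alpha> \<^bold>\<rightarrow> falsum) \<approx> falsum"
  unfolding equi_def
  by (rule conjI[OF ent_MP[OF ent_conj1[OF ent_refl] ent_conj2[OF ent_refl]] ent_falsum])

section \<open>The Lindenbaum-Tarski algebra\<close>

instance fm :: countable
  by countable_datatype

text \<open>The algebra must have its carrier inside the given type \<open>'a\<close>, so each class
  is named by an element of \<open>'a\<close>: choose a representative, encode it as a natural
  number, and inject the naturals into the infinite universe.\<close>

lemma ex_class_map:
  assumes "infinite (UNIV :: 'a set)"
  obtains q :: "fm \<Rightarrow> 'a" where "\<And>\<alpha> \<beta>. q \<alpha> = q \<beta> \<longleftrightarrow> \<alpha> \<approx> \<beta>"
proof -
  obtain f :: "nat \<Rightarrow> 'a" where f: "inj f"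
    using infinite_countable_subset[OF assms] by blast
  define rep where "rep \<alpha> = (SOME \<beta>. \<alpha> \<approx> \<beta>)" for \<alpha>
  have rep: "\<alpha> \<approx> rep \<alpha>" for \<alpha>
    unfolding rep_def by (rule someI) (rule equivp_reflp[OF equivp_equi])
  have "rep \<alpha> = rep \<beta> \<longleftrightarrow> \<alpha> \<approx> \<beta>" for \<alpha> \<beta>
  proof
    assume "rep \<alpha> = rep \<beta>"
    with rep[of \<alpha>] rep[of \<beta>] show "\<alpha> \<approx> \<beta>"
      by (metis equivp_equi equivp_symp equivp_transp)
  next
    assume "\<alpha> \<approx> \<beta>"
    \<comment> \<open>Equivalent formulas determine the same predicate, hence the same choice by
      \<open>SOME\<close>.\<close>
    then have "(\<approx>) \<alpha> = (\<approx>) \<beta>"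
      using equivp_equi by (simp add: equivp_def)
    then show "rep \<alpha> = rep \<beta>" by (simp add: rep_def)
  qed
  then show ?thesis
    using f by (intro that[of "\<lambda>\<alpha>. f (to_nat (rep \<alpha>))"]) (simp add: inj_eq)
qed

text \<open>\<open>inv q\<close> picks a representative of a class. Off \<open>range q\<close> the
  operations take arbitrary values, which is harmless because that range is the carrier.\<close>

definition lindenbaum :: "(fm \<Rightarrow> 'a) \<Rightarrow> 'a lfi_algebra" where
  "lindenbaum q =
    \<lparr>carrier = range q,
     meet = (\<lambda>x y. q (inv q x \<^bold>\<and> inv q y)),
     join = (\<lambda>x y. q (inv q x \<^bold>\<or> inv q y)),
     imp = (\<lambda>x y. q (inv q x \<^bold>\<rightarrow> inv q y)),
     neg = (\<lambda>x. q (\<^bold>\<not> inv q x)),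
     circ = (\<lambda>x. q (\<^bold>\<circ> inv q x)),
     zero = q falsum,
     one = q verum\<rparr>"

section \<open>The quotient as a BALFI, for any \<open>q\<close> with kernel
  \<open>\<approx>\<close>\<close>

context
  fixes q :: "fm \<Rightarrow> 'a"
  assumes q_eq_iff: "\<And>\<alpha> \<beta>. q \<alpha> = q \<beta> \<longleftrightarrow> \<alpha> \<approx> \<beta>"
begin

lemma inv_class: "inv q (q \<alpha>) \<approx> \<alpha>"
  by (simp flip: q_eq_iff add: f_inv_into_f)

text \<open>The congruence lemmas absorb the choice of representatives made by
  \<open>inv q\<close>.\<close>

lemma lindenbaum_simps:
  "carrier (lindenbaum q) = range q"
  "meet (lindenbaum q) (q \<alpha>) (q \<beta>) = q (\<alpha> \<^bold>\<and> \<beta>)"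
  "join (lindenbaum q) (q \<alpha>) (q \<beta>) = q (\<alpha> \<^bold>\<or> \<beta>)"
  "imp (lindenbaum q) (q \<alpha>) (q \<beta>) = q (\<alpha> \<^bold>\<rightarrow> \<beta>)"
  "neg (lindenbaum q) (q \<alpha>) = q (\<^bold>\<not> \<alpha>)"
  "circ (lindenbaum q) (q \<alpha>) = q (\<^bold>\<circ> \<alpha>)"
  "zero (lindenbaum q) = q falsum"
  "one (lindenbaum q) = q verum"
  by (simp_all add: lindenbaum_def q_eq_iff equi_conj equi_disj equi_imp equi_neg equi_circ
      inv_class)

lemma valuation_lindenbaum: "valuation (lindenbaum q) q"
  by (simp add: valuation_def lindenbaum_simps)

lemma balfi_lindenbaum: "balfi (lindenbaum q)"
  \<comment> \<open>Carrier elements have the form \<open>q \<alpha>\<close>, so each equational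
    axiom reduces through \<open>q_eq_iff\<close> to one of the equivalences above.\<close>
  by unfold_locales
    (auto simp: lindenbaum_simps rangeI q_eq_iff equi_conj_assoc equi_conj_commute equi_disj_assoc
      equi_disj_commute equi_conj_disj_distrib equi_disj_conj_distrib equi_conj_verum
      equi_disj_falsum equi_conj_compl equi_disj_compl equi_imp_disj equi_disj_neg
      equi_conj_neg_circ)

lemma iter_right_lindenbaum:
  assumes "\<gamma>s \<noteq> []"
  shows "iter_right (meet (lindenbaum q)) (map q \<gamma>s) = q (iter_right Conj \<gamma>s)"
  using assms
proof (induction \<gamma>s rule: list_nonempty_induct)
  case (cons \<gamma> \<gamma>s)
  \<comment> \<open>The recursive equation of \<open>iter_right\<close> needs two visible elements,
    hence the split of the tail.\<close>
  then show ?case by (cases \<gamma>s) (simp_all add: lindenbaum_simps)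
qed simp

end

theorem theorem2p15:
  fixes \<Gamma> :: "fm set" and \<phi> :: fm
  assumes "infinite (UNIV :: 'a set)"
    and "BI_consequence TYPE('a) \<Gamma> \<phi>"
  shows "\<Gamma> \<turnstile>\<^sub>R\<^sub>m\<^sub>b\<^sub>C \<phi>"
proof -
  obtain q :: "fm \<Rightarrow> 'a" where q: "\<And>\<alpha> \<beta>. q \<alpha> = q \<beta> \<longleftrightarrow> \<alpha> \<approx> \<beta>"
    using ex_class_map[OF assms(1)] by blast
  note simps = lindenbaum_simps[OF q]
  note B = balfi_lindenbaum[OF q] valuation_lindenbaum[OF q]
  \<comment> \<open>The second alternative of semantic consequence is instantiated at the Lindenbaum
    algebra with its class map as valuation.\<close>
  from assms(2) consider "BI_valid TYPE('a) \<phi>"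
    | \<gamma>s where "\<gamma>s \<noteq> []" "set \<gamma>s \<subseteq> \<Gamma>"
        "le (lindenbaum q) (iter_right (meet (lindenbaum q)) (map q \<gamma>s)) (q \<phi>)"
    unfolding BI_consequence_def using B by blast
  then show ?thesis
  proof cases
    case 1
    then have "q \<phi> = q verum"
      using B unfolding BI_valid_def by (metis simps(8))
    then show ?thesis by (simp add: q equi_verum_iff RmbC_consequence_def)
  next
    case 2
    \<comment> \<open>The iterated meet of classes is the class of the iterated conjunction, and
      \<open>le\<close> then unfolds to absorption.\<close>
    then have "iter_right Conj \<gamma>s \<preceq> \<phi>"
      by (simp add: iter_right_lindenbaum[OF q] le_def simps q equi_conj_absorb_iff)
    with 2 show ?thesis by (auto simp: RmbC_consequence_def ent_def)
  qed
qed

end
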